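(* There is a constant $C_n>0$ depending only on $n$ such that the following holds. Let $f\in\mathrm{BLO}(\mathbb{R}^n)$ and let $u(x,t)=W_tf(x)$ be the solution to the heat equation $\partial_tu=\Delta u$ in $\mathbb{R}^n\times(0,\infty)$, $u(x,0)=f(x)$ on $\mathbb{R}^n$. Then for all $x\in\mathbb{R}^n$ and $t>0$, $$u(x,t)\le\operatorname*{ess\,inf}_{z\in B(x,\sqrt t)}f(z)+C_n\|f\|_{\mathrm{BLO}(\mathbb{R}^n)}.$$ Consequently, at every Lebesgue point $x$ of $f$, $$\sup_{t>0}\big(W_tf(x)-f(x)\big)\le C_n\|f\|_{\mathrm{BLO}(\mathbb{R}^n)}.$$
   Context: $\mathrm{BLO}(\mathbb{R}^n)$ is the set of real-valued locally integrable functions $f$ on $\mathbb{R}^n$ with $\|f\|_{\mathrm{BLO}(\mathbb{R}^n)}:=\sup_B\frac1{|B|}\int_B\big[f(x)-\operatorname{ess\,inf}_B f\big]\,dx<\infty$, the supremum being over all balls $B\subset\mathbb{R}^n$. The heat semigroup is $W_tf(x)=\int_{\mathbb{R}^n}W_t(x-y)f(y)\,dy$ with $W_t(x-y)=(4\pi t)^{-n/2}\exp(-|x-y|^2/(4t))$, $t>0$. $B(x,r)$ is the ball of center $x$ and radius $r$. A Lebesgue point of $f$ is a point $x$ with $\lim_{r\to0}\frac1{|B(x,r)|}\int_{B(x,r)}|f(y)-f(x)|\,dy=0$. *)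

theory Defs
  imports "HOL-Analysis.Analysis"
begin

definition locally_integrable :: "(real ^ 'n \<Rightarrow> real) \<Rightarrow> bool" where
  "locally_integrable f \<longleftrightarrow> (\<forall>K. compact K \<longrightarrow> set_integrable lebesgue K f)"

text \<open>The essential infimum is extended-real-valued: it is \<open>- \<infinity>\<close> if \<open>f\<close> is not
  essentially bounded below on \<open>B\<close>.\<close>

definition ess_inf :: "(real ^ 'n) set \<Rightarrow> (real ^ 'n \<Rightarrow> real) \<Rightarrow> ereal" where
  "ess_inf B f = Sup {c. AE x in lebesgue. x \<in> B \<longrightarrow> c \<le> ereal (f x)}"

text \<open>The integrand \<open>f y - ess_inf B f\<close> is nonnegative for almost every \<open>y \<in> B\<close>, so the
  truncation at \<open>0\<close> performed by \<open>e2ennreal\<close> does not change the integral.  The mean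
  oscillation is \<open>\<infinity>\<close> whenever the essential infimum is \<open>- \<infinity>\<close>.\<close>

definition blo_norm :: "(real ^ 'n \<Rightarrow> real) \<Rightarrow> ennreal" where
  "blo_norm f =
     (SUP (x, r) \<in> UNIV \<times> {0<..}.
        (\<integral>\<^sup>+ y \<in> ball x r. e2ennreal (ereal (f y) - ess_inf (ball x r) f) \<partial>lebesgue)
          / emeasure lebesgue (ball x r))"

definition BLO :: "(real ^ 'n \<Rightarrow> real) set" where
  "BLO = {f. locally_integrable f \<and> blo_norm f < \<infinity>}"

definition heat_kernel :: "real \<Rightarrow> real ^ 'n \<Rightarrow> real" where
  "heat_kernel t z =
     (4 * pi * t) powr (- real CARD('n) / 2) * exp (- (norm z)\<^sup>2 / (4 * t))"

definition heat_semigroup :: "real \<Rightarrow> (real ^ 'n \<Rightarrow> real) \<Rightarrow> real ^ 'n \<Rightarrow> real" where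
  "heat_semigroup t f x = (\<integral>y. heat_kernel t (x - y) * f y \<partial>lebesgue)"

definition lebesgue_point :: "(real ^ 'n \<Rightarrow> real) \<Rightarrow> real ^ 'n \<Rightarrow> bool" where
  "lebesgue_point f x \<longleftrightarrow>
     ((\<lambda>r. (LINT y:ball x r|lebesgue. \<bar>f y - f x\<bar>) / measure lebesgue (ball x r)) \<longlongrightarrow> 0)
       (at_right 0)"

end

theory Submission
  imports Defs "HOL-Probability.Distributions" "HOL-Real_Asymp.Real_Asymp"
begin

text \<open>Let \<open>m\<close> and \<open>m'\<close> be the essential infima of \<open>f\<close> over \<open>B(x,r)\<close> and \<open>B(x,sr)\<close>,
  \<open>s \<ge> 1\<close>, and let \<open>N\<close> be the BLO norm.  Since \<open>f - m' \<ge> 0\<close> on the large ball, its integral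
  over the small ball is at most \<open>N |B(x,sr)|\<close>, so \<open>m - m' \<le> N s^n\<close>.  Hence \<open>|f - m|\<close> has
  mean at most \<open>N (1 + s^n)\<close> over \<open>B(x,sr)\<close>.  This crude polynomial growth suffices against the
  Gaussian: with \<open>r = sqrt t\<close>, the integral of \<open>W_t(x - y) |f(y) - m|\<close> is at most \<open>C N\<close>, which
  gives both integrability and the upper bound, as \<open>W_t\<close> has total mass 1.  At a Lebesgue point
  \<open>m \<le> f x\<close>.\<close>

section \<open>Essential infima and volumes of balls\<close>

text \<open>Each admissible \<open>c\<close> has its own exceptional null set, and there may be
  uncountably many of them. The supremum is already that of a sequence of admissible values, so a
  countable union of null sets suffices.\<close>

lemma AE_ess_inf_le: "AE x in lebesgue. x \<in> B \<longrightarrow> ess_inf B f \<le> ereal (f x)"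
proof -
  let ?A = "{c. AE x in lebesgue. x \<in> B \<longrightarrow> c \<le> ereal (f x)}"
  have "-\<infinity> \<in> ?A" by simp
  then obtain g :: "nat \<Rightarrow> ereal" where g: "range g \<subseteq> ?A" "Sup ?A = (SUP i. g i)"
    using Sup_countable_SUP[of ?A] by (metis (no_types, lifting) empty_iff)
  have "AE x in lebesgue. \<forall>i. x \<in> B \<longrightarrow> g i \<le> ereal (f x)"
    unfolding AE_all_countable using g(1) by auto
  then show ?thesis
    unfolding ess_inf_def g(2) by eventually_elim (auto intro: SUP_least)
qed

lemma ess_inf_greatest:
  assumes "AE x in lebesgue. x \<in> B \<longrightarrow> c \<le> ereal (f x)"
  shows "c \<le> ess_inf B f"
  unfolding ess_inf_def using assms by (auto intro: Sup_upper)

lemma ess_inf_antimono: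
  assumes "A \<subseteq> B"
  shows "ess_inf B f \<le> ess_inf A f"
proof (rule ess_inf_greatest)
  show "AE x in lebesgue. x \<in> A \<longrightarrow> ess_inf B f \<le> ereal (f x)"
    using AE_ess_inf_le[of B f] by eventually_elim (use assms in auto)
qed

lemma emeasure_lebesgue_ball:
  fixes x :: "real ^ 'n"
  assumes "r \<ge> 0"
  shows "emeasure lebesgue (ball x r) = ennreal (unit_ball_vol (real CARD('n)) * r ^ CARD('n))"
  using emeasure_ball[of r x] assms by simp

lemma emeasure_lebesgue_ball_nonzero:
  fixes x :: "real ^ 'n"
  assumes "r > 0"
  shows "emeasure lebesgue (ball x r) \<noteq> 0"
proof -
  have "unit_ball_vol (real CARD('n)) * r ^ CARD('n) > 0"
    using assms by (intro mult_pos_pos unit_ball_vol_pos zero_less_power) auto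
  then show ?thesis
    unfolding emeasure_lebesgue_ball[OF less_imp_le[OF assms]] by (simp only: ennreal_eq_0_iff not_le)
qed

text \<open>Since \<open>f\<close> is real-valued, the value \<infinity> would make the whole ball a
  null set.\<close>

lemma ess_inf_less_PInf:
  fixes f :: "real ^ 'n \<Rightarrow> real"
  assumes "r > 0"
  shows "ess_inf (ball x r) f < \<infinity>"
proof (rule ccontr)
  assume "\<not> ess_inf (ball x r) f < \<infinity>"
  then have "AE y in lebesgue. y \<notin> ball x r"
    using AE_ess_inf_le[of "ball x r" f] by (auto elim!: eventually_mono)
  then have "emeasure lebesgue (ball x r) = 0"
    by (subst (asm) AE_iff_measurable[of "ball x r"]) auto
  then show False
    using emeasure_lebesgue_ball_nonzero[OF assms] by blast
qed

section \<open>Oscillation of BLO functions over balls\<close>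

text \<open>The truncations of \<open>f\<close> to closed balls of integer radius are measurable,
  and at each point they eventually equal \<open>f\<close>.\<close>

lemma borel_measurable_locally_integrable:
  fixes f :: "real ^ 'n \<Rightarrow> real"
  assumes "locally_integrable f"
  shows "f \<in> borel_measurable lebesgue"
proof (rule borel_measurable_LIMSEQ_real)
  fix k :: nat
  show "(\<lambda>y. indicator (cball 0 (real k)) y *\<^sub>R f y) \<in> borel_measurable lebesgue"
    using assms unfolding locally_integrable_def set_integrable_def
    by (meson borel_measurable_integrable compact_cball)
next
  fix y :: "real ^ 'n"
  obtain K :: nat where K: "norm y \<le> real K" using real_arch_simple by blast
  have "\<forall>\<^sub>F k in sequentially. indicator (cball 0 (real k)) y *\<^sub>R f y = f y"
    using eventually_ge_at_top[of K]
    by eventually_elim (use K in \<open>auto simp: indicator_def\<close>)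
  then show "(\<lambda>k. indicator (cball 0 (real k)) y *\<^sub>R f y) \<longlonglongrightarrow> f y"
    by (rule tendsto_eventually)
qed

text \<open>Trades the extended-valued supremum in \<open>blo_norm\<close> for a real
  \<open>m\<close> and a finite bound on a single ball, so that later estimates run in real
  arithmetic.\<close>

lemma BLO_oscillation:
  fixes f :: "real ^ 'n \<Rightarrow> real"
  assumes f: "f \<in> BLO" and r: "r > 0"
  obtains m where "ess_inf (ball x r) f = ereal m"
    and "(\<integral>\<^sup>+ y \<in> ball x r. ennreal (f y - m) \<partial>lebesgue)
           \<le> ennreal (enn2real (blo_norm f) * (unit_ball_vol (real CARD('n)) * r ^ CARD('n)))"
proof -
  let ?B = "ball x r"
  let ?I = "\<integral>\<^sup>+ y \<in> ?B. e2ennreal (ereal (f y) - ess_inf ?B f) \<partial>lebesgue"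
  have pos: "emeasure lebesgue ?B \<noteq> 0"
    by (rule emeasure_lebesgue_ball_nonzero[OF r])
  have vol: "emeasure lebesgue ?B = ennreal (unit_ball_vol (real CARD('n)) * r ^ CARD('n))"
    using r by (simp only: emeasure_lebesgue_ball less_imp_le)
  have le: "?I / emeasure lebesgue ?B \<le> blo_norm f"
    unfolding blo_norm_def by (rule SUP_upper2[of "(x, r)"]) (use r in auto)
  have fin: "blo_norm f = ennreal (enn2real (blo_norm f))" using f by (simp add: BLO_def)
  \<comment> \<open>Dividing by the volume and multiplying back is legitimate because the volume is
    neither 0 nor \<infinity>.\<close>
  have "?I = ?I / emeasure lebesgue ?B * emeasure lebesgue ?B"
    unfolding ennreal_divide_times
    by (subst ennreal_divide_self) (use pos in \<open>simp_all only: vol ennreal_less_top mult_1_right not_False_eq_True\<close>)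
  also have "\<dots> \<le> blo_norm f * emeasure lebesgue ?B"
    by (rule mult_right_mono[OF le]) simp
  also have "\<dots> = ennreal (enn2real (blo_norm f) * (unit_ball_vol (real CARD('n)) * r ^ CARD('n)))"
    unfolding vol by (subst fin) (simp add: ennreal_mult')
  finally have I: "?I \<le> \<dots>" .
  \<comment> \<open>Otherwise the integrand would be \<infinity> throughout a ball of positive
    volume, against the finite bound \<open>I\<close>.\<close>
  have "ess_inf ?B f \<noteq> -\<infinity>"
  proof
    assume "ess_inf ?B f = -\<infinity>"
    then have "?I = (\<integral>\<^sup>+ y. \<infinity> * indicator ?B y \<partial>lebesgue)"
      by simp
    also have "\<dots> = \<infinity>"
      using pos by (subst nn_integral_cmult_indicator) (auto simp: ennreal_top_mult)
    finally show False
      using I by (simp add: top_unique)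
  qed
  then obtain m where m: "ess_inf ?B f = ereal m"
    using ess_inf_less_PInf[OF r, of x f] by (cases "ess_inf ?B f") auto
  show thesis
    by (rule that[OF m]) (use I in \<open>simp add: m\<close>)
qed

text \<open>The reference value \<open>m\<close> stays that of the undilated ball for every
  \<open>s\<close>, so a single constant can be subtracted from \<open>f\<close> in all the shells
  of the heat integral.\<close>

lemma BLO_dilated_oscillation:
  fixes f :: "real ^ 'n \<Rightarrow> real"
  assumes f: "f \<in> BLO" and r: "r > 0" and s: "s \<ge> 1"
    and m: "ess_inf (ball x r) f = ereal m"
  shows "(\<integral>\<^sup>+ y \<in> ball x (s * r). ennreal \<bar>f y - m\<bar> \<partial>lebesgue)
           \<le> ennreal (enn2real (blo_norm f) * (1 + s ^ CARD('n))
               * (unit_ball_vol (real CARD('n)) * (s * r) ^ CARD('n)))"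
proof -
  define N where "N = enn2real (blo_norm f)"
  define v where "v = unit_ball_vol (real CARD('n)) * r ^ CARD('n)"
  have N: "N \<ge> 0" by (simp add: N_def)
  have v: "v > 0"
    unfolding v_def using r by (intro mult_pos_pos unit_ball_vol_pos zero_less_power) auto
  have sr: "s * r > 0" using r s by simp
  have vs: "unit_ball_vol (real CARD('n)) * (s * r) ^ CARD('n) = s ^ CARD('n) * v"
    by (simp add: v_def power_mult_distrib)
  have vol: "emeasure lebesgue (ball x r) = ennreal v"
    "emeasure lebesgue (ball x (s * r)) = ennreal (s ^ CARD('n) * v)"
    using r sr by (simp_all only: emeasure_lebesgue_ball less_imp_le v_def vs)
  have sub: "ball x r \<subseteq> ball x (s * r)"
    using r s by (intro subset_ball) simp
  have [measurable]: "f \<in> borel_measurable lebesgue"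
    using f by (intro borel_measurable_locally_integrable) (simp add: BLO_def)
  obtain m' where m': "ess_inf (ball x (s * r)) f = ereal m'"
    and I: "(\<integral>\<^sup>+ y \<in> ball x (s * r). ennreal (f y - m') \<partial>lebesgue) \<le> ennreal (N * (s ^ CARD('n) * v))"
    using BLO_oscillation[OF f sr, of x] unfolding vs N_def by metis
  have [measurable]: "ball x r \<in> sets lebesgue" for x :: "real ^ 'n" and r
    by simp
  have mm: "m' \<le> m"
    using ess_inf_antimono[OF sub, of f] by (simp add: m m')
  have ae: "AE y in lebesgue. y \<in> ball x (s * r) \<longrightarrow> m' \<le> f y"
    using AE_ess_inf_le[of "ball x (s * r)" f] by (simp add: m')
  have ae2: "AE y in lebesgue. y \<in> ball x r \<longrightarrow> m \<le> f y"
    using AE_ess_inf_le[of "ball x r" f] by (simp add: m)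
  \<comment> \<open>Almost everywhere on the small ball \<open>m - m' \<le> f y - m'\<close>;
    enlarging the domain only increases the integral. The ratio of the two volumes is the source of
    the factor \<open>s ^ CARD('n)\<close> in \<open>diff\<close>.\<close>
  have "ennreal ((m - m') * v) = (\<integral>\<^sup>+ y. ennreal (m - m') * indicator (ball x r) y \<partial>lebesgue)"
    using mm v by (subst nn_integral_cmult_indicator) (simp_all add: vol ennreal_mult)
  also have "\<dots> \<le> (\<integral>\<^sup>+ y \<in> ball x (s * r). ennreal (f y - m') \<partial>lebesgue)"
    by (rule nn_integral_mono_AE, use ae2 in eventually_elim)
      (use sub in \<open>auto simp: indicator_def intro!: ennreal_leI\<close>)
  also note I
  finally have "(m - m') * v \<le> N * s ^ CARD('n) * v"
    using N v s by (simp add: mult_ac)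
  then have diff: "m - m' \<le> N * s ^ CARD('n)"
    using v by simp
  \<comment> \<open>Almost everywhere on the large ball both \<open>f y - m'\<close> and
    \<open>m - m'\<close> are nonnegative, and their sum dominates
    \<open>\<bar>f y - m\<bar>\<close> by the triangle inequality.\<close>
  have "(\<integral>\<^sup>+ y \<in> ball x (s * r). ennreal \<bar>f y - m\<bar> \<partial>lebesgue)
      \<le> (\<integral>\<^sup>+ y. ennreal (f y - m') * indicator (ball x (s * r)) y
              + ennreal (m - m') * indicator (ball x (s * r)) y \<partial>lebesgue)"
    by (rule nn_integral_mono_AE, use ae in eventually_elim)
      (use mm in \<open>auto simp: indicator_def ennreal_plus[symmetric] intro!: ennreal_leI simp del: ennreal_plus\<close>)
  also have "\<dots> = (\<integral>\<^sup>+ y \<in> ball x (s * r). ennreal (f y - m') \<partial>lebesgue)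
              + ennreal (m - m') * ennreal (s ^ CARD('n) * v)"
    by (subst nn_integral_add) (simp_all add: nn_integral_cmult_indicator vol(2)[simplified] borel_measurable_indicator')
  also have "\<dots> \<le> ennreal (N * (s ^ CARD('n) * v)) + ennreal (N * s ^ CARD('n)) * ennreal (s ^ CARD('n) * v)"
    by (intro add_mono I mult_right_mono ennreal_leI diff) simp
  also have "\<dots> = ennreal (N * (1 + s ^ CARD('n)) * (s ^ CARD('n) * v))"
    using N v s by (simp add: ennreal_mult[symmetric] ennreal_plus[symmetric] algebra_simps del: ennreal_plus)
  finally show ?thesis unfolding vs N_def .
qed

section \<open>The Gaussian kernel: shell decomposition, total mass and coefficients\<close>

lemma heat_kernel_nonneg: "heat_kernel t z \<ge> 0"
  by (simp add: heat_kernel_def)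

lemma borel_measurable_heat_kernel [measurable]: "heat_kernel t \<in> borel_measurable borel"
  unfolding heat_kernel_def by measurable

text \<open>The single term of the shell containing \<open>y\<close> already dominates. Full balls
  replace the disjoint shells so that \<open>BLO_dilated_oscillation\<close> applies to each
  term.\<close>

lemma heat_kernel_le_suminf:
  fixes x y :: "real ^ 'n"
  assumes t: "t > 0"
  shows "ennreal (heat_kernel t (x - y))
    \<le> (\<Sum>k. ennreal ((4 * pi * t) powr (- real CARD('n) / 2) * exp (- (real k)\<^sup>2 / 4))
            * indicator (ball x ((real k + 1) * sqrt t)) y)"
    (is "_ \<le> (\<Sum>k. ?a k)")
proof -
  define q where "q = dist x y / sqrt t"
  \<comment> \<open>Rounding down gives \<open>k \<le> q\<close>, which bounds the exponential, and
    the strict \<open>q < k + 1\<close>, which puts \<open>y\<close> in the open ball.\<close>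
  define k where "k = nat \<lfloor>q\<rfloor>"
  have st: "sqrt t > 0" using t by simp
  have q0: "q \<ge> 0" unfolding q_def using st by (intro divide_nonneg_pos) auto
  then have k: "real k \<le> q" "q < real k + 1"
    unfolding k_def by auto
  have "dist x y = q * sqrt t" using st by (simp add: q_def)
  then have mem: "y \<in> ball x ((real k + 1) * sqrt t)" using k st by simp
  have sq: "(norm (x - y))\<^sup>2 = q\<^sup>2 * t"
    using t by (simp add: q_def dist_norm power_divide)
  have "(real k)\<^sup>2 \<le> q\<^sup>2" by (rule power_mono[OF k(1)]) simp
  then have "heat_kernel t (x - y) \<le> (4 * pi * t) powr (- real CARD('n) / 2) * exp (- (real k)\<^sup>2 / 4)"
    unfolding heat_kernel_def sq using t by (intro mult_left_mono) auto
  then have "ennreal (heat_kernel t (x - y)) \<le> ?a k"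
    using mem by (simp add: ennreal_leI)
  also have "\<dots> \<le> (\<Sum>k. ?a k)"
  proof -
    have "a j \<le> (\<Sum>k. a k)" for a :: "nat \<Rightarrow> ennreal" and j
      using sum_le_suminf[of a "{j}"] by simp
    then show ?thesis .
  qed
  finally show ?thesis .
qed

text \<open>The kernel factors over the coordinates into normal densities, each of mass 1.\<close>

lemma nn_integral_heat_kernel:
  fixes x :: "real ^ 'n"
  assumes t: "t > 0"
  shows "(\<integral>\<^sup>+ y. ennreal (heat_kernel t (x - y)) \<partial>lebesgue) = 1"
proof -
  \<comment> \<open>Variance \<open>2 * t\<close> turns the density's exponent into
    \<open>- (y \<bullet> b - x \<bullet> b)\<^sup>2 / (4 * t)\<close> and its prefactor into
    \<open>1 / sqrt (4 * pi * t)\<close>.\<close>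
  let ?s = "sqrt (2 * t)"
  have kernel: "ennreal (heat_kernel t (x - y))
      = (\<Prod>b\<in>Basis. ennreal (normal_density (x \<bullet> b) ?s (y \<bullet> b)))" for y :: "real ^ 'n"
  proof -
    have "(norm (x - y))\<^sup>2 = (\<Sum>b\<in>Basis. (y \<bullet> b - x \<bullet> b)\<^sup>2)"
      unfolding power2_norm_eq_inner
      by (subst euclidean_inner) (simp add: inner_diff_left power2_eq_square algebra_simps)
    then have e: "exp (- (norm (x - y))\<^sup>2 / (4 * t)) = (\<Prod>b\<in>Basis. exp (- (y \<bullet> b - x \<bullet> b)\<^sup>2 / (4 * t)))"
      by (simp add: exp_sum[symmetric] sum_negf sum_divide_distrib)
    have "(4 * pi * t) powr (- real CARD('n) / 2) = ((4 * pi * t) powr (- 1 / 2)) ^ CARD('n)"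
      using t by (simp add: powr_powr powr_realpow[symmetric])
    also have "(4 * pi * t) powr (- 1 / 2) = 1 / sqrt (4 * pi * t)"
      using t powr_minus_divide[of "4 * pi * t" "1 / 2"] by (simp add: powr_half_sqrt)
    finally have c: "(4 * pi * t) powr (- real CARD('n) / 2) = (\<Prod>b\<in>(Basis :: (real ^ 'n) set). 1 / sqrt (4 * pi * t))"
      by simp
    have "heat_kernel t (x - y) = (\<Prod>b\<in>Basis. normal_density (x \<bullet> b) ?s (y \<bullet> b))"
      unfolding heat_kernel_def e c prod.distrib[symmetric] normal_density_def
      using t by (intro prod.cong) (simp_all add: mult_ac)
    then show ?thesis by (simp add: prod_ennreal)
  qed
  have "(\<integral>\<^sup>+ y. ennreal (heat_kernel t (x - y)) \<partial>lebesgue)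
      = (\<integral>\<^sup>+ y. (\<Prod>b\<in>Basis. ennreal (normal_density (x \<bullet> b) ?s (y \<bullet> b))) \<partial>lborel)"
    by (simp add: nn_integral_completion kernel)
  also have "\<dots> = (\<Prod>b\<in>(Basis :: (real ^ 'n) set). \<integral>\<^sup>+ z. ennreal (normal_density (x \<bullet> b) ?s z) \<partial>lborel)"
    by (rule nn_integral_lborel_prod) auto
  also have "\<dots> = 1"
    using t by (simp add: nn_integral_eq_integral)
  finally show ?thesis .
qed

text \<open>The \<open>k\<close>-th term bounds the contribution of the shell \<open>k \<le> |x - y| / sqrt t < k + 1\<close>,
  per unit of BLO norm.\<close>

definition heat_coeff :: "nat \<Rightarrow> nat \<Rightarrow> real" where
  "heat_coeff n k = (4 * pi) powr (- real n / 2) * unit_ball_vol (real n)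
     * (exp (- (real k)\<^sup>2 / 4) * (1 + (real k + 1) ^ n) * (real k + 1) ^ n)"

lemma heat_coeff_nonneg: "heat_coeff n k \<ge> 0"
  by (simp add: heat_coeff_def)

text \<open>The Gaussian factor beats a polynomial of degree \<open>2 * n\<close> in
  \<open>k\<close>, so comparison with the inverse squares is enough.\<close>

lemma summable_heat_coeff: "summable (heat_coeff n)"
proof -
  have "(\<lambda>k::nat. exp (- (real k)\<^sup>2 / 4) * (1 + (real k + 1) ^ n) * (real k + 1) ^ n) \<in> O(\<lambda>k. 1 / real k ^ 2)"
    by real_asymp
  then have "summable (\<lambda>k::nat. exp (- (real k)\<^sup>2 / 4) * (1 + (real k + 1) ^ n) * (real k + 1) ^ n)"
    by (rule summable_comparison_test_bigo[rotated])
      (use inverse_power_summable[of 2, where 'a = real] in \<open>simp add: divide_inverse\<close>)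
  then show ?thesis unfolding heat_coeff_def by (rule summable_mult)
qed

section \<open>Heat integrals of BLO functions\<close>

text \<open>Insert the shell bound for the kernel, exchange sum and integral, and estimate each
  ball. All terms are nonnegative, so the exchange presupposes no integrability.\<close>

lemma nn_integral_heat_kernel_BLO:
  fixes f :: "real ^ 'n \<Rightarrow> real"
  assumes f: "f \<in> BLO" and t: "t > 0" and m: "ess_inf (ball x (sqrt t)) f = ereal m"
  shows "(\<integral>\<^sup>+ y. ennreal (heat_kernel t (x - y) * \<bar>f y - m\<bar>) \<partial>lebesgue)
           \<le> ennreal (enn2real (blo_norm f) * (\<Sum>k. heat_coeff CARD('n) k))"
proof -
  define N where "N = enn2real (blo_norm f)"
  define w where "w = (4 * pi * t) powr (- real CARD('n) / 2)"
  let ?B = "\<lambda>k::nat. ball x ((real k + 1) * sqrt t)"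
  have [measurable]: "f \<in> borel_measurable lebesgue"
    using f by (intro borel_measurable_locally_integrable) (simp add: BLO_def)
  have N: "N \<ge> 0" by (simp add: N_def)
  have w: "w \<ge> 0" by (simp add: w_def)
  have [measurable]: "?B k \<in> sets lebesgue" for k
    by simp
  \<comment> \<open>The powers of \<open>t\<close> in the kernel's prefactor and in the ball volumes
    cancel; this makes the final constant independent of \<open>t\<close>.\<close>
  have w_eq: "w * sqrt t ^ CARD('n) = (4 * pi) powr (- real CARD('n) / 2)"
  proof -
    have "sqrt t ^ CARD('n) = t powr (real CARD('n) / 2)"
      using t by (simp add: powr_half_sqrt[symmetric] powr_realpow[symmetric] powr_powr)
    then show ?thesis
      using t by (simp add: w_def powr_mult powr_minus)
  qed
  have "(\<integral>\<^sup>+ y. ennreal (heat_kernel t (x - y) * \<bar>f y - m\<bar>) \<partial>lebesgue)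
     \<le> (\<integral>\<^sup>+ y. (\<Sum>k. ennreal (w * exp (- (real k)\<^sup>2 / 4)) * (ennreal \<bar>f y - m\<bar> * indicator (?B k) y)) \<partial>lebesgue)"
  proof (rule nn_integral_mono)
    fix y
    have "ennreal (heat_kernel t (x - y) * \<bar>f y - m\<bar>)
        \<le> (\<Sum>k. ennreal (w * exp (- (real k)\<^sup>2 / 4)) * indicator (?B k) y) * ennreal \<bar>f y - m\<bar>"
      using heat_kernel_le_suminf[OF t, of x y]
      by (simp add: ennreal_mult heat_kernel_nonneg w_def mult_right_mono)
    then show "ennreal (heat_kernel t (x - y) * \<bar>f y - m\<bar>)
        \<le> (\<Sum>k. ennreal (w * exp (- (real k)\<^sup>2 / 4)) * (ennreal \<bar>f y - m\<bar> * indicator (?B k) y))"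
      by (simp add: ennreal_suminf_multc[symmetric] mult_ac)
  qed
  also have "\<dots> = (\<Sum>k. ennreal (w * exp (- (real k)\<^sup>2 / 4)) * (\<integral>\<^sup>+ y \<in> ?B k. ennreal \<bar>f y - m\<bar> \<partial>lebesgue))"
    by (subst nn_integral_suminf) (simp_all add: nn_integral_cmult)
  also have "\<dots> \<le> (\<Sum>k. ennreal (N * heat_coeff CARD('n) k))"
  proof (rule suminf_le)
    fix k :: nat
    have "ennreal (w * exp (- (real k)\<^sup>2 / 4)) * (\<integral>\<^sup>+ y \<in> ?B k. ennreal \<bar>f y - m\<bar> \<partial>lebesgue)
       \<le> ennreal (w * exp (- (real k)\<^sup>2 / 4)) * ennreal (N * (1 + (real k + 1) ^ CARD('n))
               * (unit_ball_vol (real CARD('n)) * ((real k + 1) * sqrt t) ^ CARD('n)))"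
      \<comment> \<open>The dilation factor is \<open>s = real k + 1\<close>, at least 1 from
        \<open>k = 0\<close> on, with base radius \<open>sqrt t\<close>.\<close>
      unfolding N_def by (intro mult_left_mono BLO_dilated_oscillation f m) (use t in auto)
    also have "\<dots> = ennreal (N * heat_coeff CARD('n) k)"
      unfolding heat_coeff_def w_eq[symmetric] using N w t
      by (subst ennreal_mult[symmetric]) (auto simp: power_mult_distrib mult_ac)
    finally show "ennreal (w * exp (- (real k)\<^sup>2 / 4)) * (\<integral>\<^sup>+ y \<in> ?B k. ennreal \<bar>f y - m\<bar> \<partial>lebesgue) \<le> \<dots>" .
  qed auto
  also have "\<dots> = ennreal (N * (\<Sum>k. heat_coeff CARD('n) k))"
    using N by (subst suminf_ennreal2)
      (auto simp: heat_coeff_nonneg summable_heat_coeff suminf_mult intro: summable_mult)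
  finally show ?thesis unfolding N_def .
qed

text \<open>Write \<open>f\<close> as \<open>(f - m) + m\<close>: the first part is controlled in
  absolute value, and the second contributes exactly \<open>m\<close> because the kernel has mass 1.
  Integrability is stated too, since the integral of a nonintegrable function defaults to 0 and
  would void the bound.\<close>

lemma heat_semigroup_BLO_bound:
  fixes f :: "real ^ 'n \<Rightarrow> real"
  assumes f: "f \<in> BLO" and t: "t > 0" and m: "ess_inf (ball x (sqrt t)) f = ereal m"
  shows "integrable lebesgue (\<lambda>y. heat_kernel t (x - y) * f y)"
    and "heat_semigroup t f x \<le> m + (\<Sum>k. heat_coeff CARD('n) k) * enn2real (blo_norm f)"
proof -
  let ?K = "\<lambda>y. heat_kernel t (x - y)"
  let ?C = "enn2real (blo_norm f) * (\<Sum>k. heat_coeff CARD('n) k)"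
  have C: "?C \<ge> 0"
    by (intro mult_nonneg_nonneg suminf_nonneg summable_heat_coeff heat_coeff_nonneg) simp
  have [measurable]: "f \<in> borel_measurable lebesgue"
    using f by (intro borel_measurable_locally_integrable) (simp add: BLO_def)
  have "?K \<in> borel_measurable lborel" by measurable
  then have [measurable]: "?K \<in> borel_measurable lebesgue"
    by (rule measurable_completion)
  have K: "has_bochner_integral lebesgue ?K 1"
    by (rule has_bochner_integral_nn_integral)
      (auto simp: heat_kernel_nonneg nn_integral_heat_kernel[OF t])
  note bound = nn_integral_heat_kernel_BLO[OF f t m]
  have int: "integrable lebesgue (\<lambda>y. ?K y * (f y - m))"
    by (rule integrableI_bounded)
      (use bound in \<open>auto simp: abs_mult heat_kernel_nonneg le_less_trans\<close>)
  have Km: "integrable lebesgue (\<lambda>y. ?K y * m)"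
    using K by (auto simp: has_bochner_integral_iff)
  have split: "?K y * f y = ?K y * (f y - m) + ?K y * m" for y
    by (simp add: algebra_simps)
  show "integrable lebesgue (\<lambda>y. ?K y * f y)"
    unfolding split by (intro Bochner_Integration.integrable_add int Km)
  have "heat_semigroup t f x = (\<integral>y. ?K y * (f y - m) \<partial>lebesgue) + m"
    unfolding heat_semigroup_def split using K
    by (subst Bochner_Integration.integral_add[OF int Km]) (auto simp: has_bochner_integral_iff)
  also have "(\<integral>y. ?K y * (f y - m) \<partial>lebesgue) \<le> (\<integral>y. ?K y * \<bar>f y - m\<bar> \<partial>lebesgue)"
    using integrable_abs[OF int]
    by (intro integral_mono int) (auto simp: abs_mult heat_kernel_nonneg mult_left_mono)
  also have "\<dots> \<le> ?C"
    using bound C by (intro integral_real_bounded) auto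
  finally show "heat_semigroup t f x \<le> m + (\<Sum>k. heat_coeff CARD('n) k) * enn2real (blo_norm f)"
    by (simp add: mult_ac)
qed

section \<open>Lebesgue points and the final estimates\<close>

text \<open>If a real \<open>c\<close> lay strictly between \<open>f x\<close> and the essential
  infimum, the mean of \<open>\<bar>f y - f x\<bar>\<close> over every ball \<open>ball x r\<close>
  with \<open>0 < r < R\<close> would be at least \<open>c - f x > 0\<close>, so it could not tend
  to 0.\<close>

lemma ess_inf_le_lebesgue_point:
  fixes f :: "real ^ 'n \<Rightarrow> real"
  assumes f: "locally_integrable f" and L: "lebesgue_point f x" and R: "R > 0"
  shows "ess_inf (ball x R) f \<le> ereal (f x)"
proof (rule ccontr)
  assume "\<not> ess_inf (ball x R) f \<le> ereal (f x)"
  then obtain c where c: "f x < c" "ereal c < ess_inf (ball x R) f"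
    using ereal_dense2[of "ereal (f x)" "ess_inf (ball x R) f"] by (auto simp: not_le)
  have "\<forall>\<^sub>F r in at_right 0. c - f x \<le> (LINT y:ball x r|lebesgue. \<bar>f y - f x\<bar>) / measure lebesgue (ball x r)"
    using eventually_at_right_less[of 0] eventually_at_right_real[OF R]
  proof eventually_elim
    case (elim r)
    let ?B = "ball x r"
    have r: "r > 0" "?B \<subseteq> ball x R" using elim by (auto intro: subset_ball)
    have vol: "measure lebesgue ?B > 0"
      using content_ball_pos[OF r(1), of x] by simp
    have "set_integrable lebesgue (cball x r) f"
      using f by (simp add: locally_integrable_def)
    then have "set_integrable lebesgue ?B f"
      by (rule set_integrable_subset) auto
    moreover have const: "set_integrable lebesgue ?B (\<lambda>y. k)" for k :: real
      unfolding set_integrable_def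
      by (intro integrable_scaleR_left)
        (use emeasure_lborel_ball_finite[of x r] in \<open>simp add: integrable_indicator_iff\<close>)
    ultimately have diff: "set_integrable lebesgue ?B (\<lambda>y. \<bar>f y - f x\<bar>)"
      by (intro set_integrable_abs set_integral_diff(1))
    have "(c - f x) * measure lebesgue ?B = (LINT y:?B|lebesgue. c - f x)"
      by (simp add: set_lebesgue_integral_def)
    also have "\<dots> \<le> (LINT y:?B|lebesgue. \<bar>f y - f x\<bar>)"
      unfolding set_lebesgue_integral_def
    proof (rule integral_mono_AE)
      show "AE y in lebesgue. indicat_real ?B y *\<^sub>R (c - f x) \<le> indicat_real ?B y *\<^sub>R \<bar>f y - f x\<bar>"
        using AE_ess_inf_le[of "ball x R" f]
      proof eventually_elim
        case (elim y)
        show ?case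
        proof (cases "y \<in> ?B")
          case True
          then have "ereal c < ereal (f y)"
            using elim r(2) c(2) by (meson less_le_trans subsetD)
          with True show ?thesis by simp
        qed simp
      qed
    qed (use diff const[of "c - f x"] in \<open>simp_all add: set_integrable_def\<close>)
    finally show ?case
      using vol by (simp add: pos_le_divide_eq)
  qed
  then have "c - f x \<le> 0"
    using L unfolding lebesgue_point_def by (intro tendsto_lowerbound) auto
  then show False using c by simp
qed

theorem corollary2p2:
  shows "\<exists>C::real. C > 0 \<and>
    (\<forall>f \<in> (BLO :: (real ^ 'n \<Rightarrow> real) set).
       (\<forall>x. \<forall>t>0.
          integrable lebesgue (\<lambda>y. heat_kernel t (x - y) * f y) \<and>
          ereal (heat_semigroup t f x)
            \<le> ess_inf (ball x (sqrt t)) f + ereal C * enn2ereal (blo_norm f)) \<and>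
       (\<forall>x. lebesgue_point f x \<longrightarrow>
          (SUP t\<in>{0<..}. ereal (heat_semigroup t f x - f x))
            \<le> ereal C * enn2ereal (blo_norm f)))"
proof (intro exI conjI ballI allI impI)
  let ?S = "\<Sum>k. heat_coeff CARD('n) k"
  \<comment> \<open>The summand 1 gives positivity from \<open>?S \<ge> 0\<close> alone; the
    constant depends only on the dimension.\<close>
  show "1 + ?S > 0"
    using suminf_nonneg[OF summable_heat_coeff heat_coeff_nonneg] by (simp add: add_pos_nonneg)
  fix f :: "real ^ 'n \<Rightarrow> real" and x :: "real ^ 'n"
  assume f: "f \<in> BLO"
  let ?N = "enn2real (blo_norm f)"
  have N: "enn2ereal (blo_norm f) = ereal ?N"
    using f by (cases "blo_norm f") (auto simp: BLO_def)
  have bound: "heat_semigroup t f x \<le> m + (1 + ?S) * ?N"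
    if "t > 0" "ess_inf (ball x (sqrt t)) f = ereal m" for t m
    using heat_semigroup_BLO_bound(2)[OF f that] enn2real_nonneg[of "blo_norm f"]
    unfolding distrib_right by linarith
  have finite: "\<exists>m. ess_inf (ball x (sqrt t)) f = ereal m" if "t > 0" for t
    using BLO_oscillation[OF f, of "sqrt t" x] that by (metis real_sqrt_gt_zero)
  {
    fix t :: real
    assume t: "t > 0"
    then obtain m where m: "ess_inf (ball x (sqrt t)) f = ereal m" using finite by blast
    show "integrable lebesgue (\<lambda>y. heat_kernel t (x - y) * f y)"
      by (rule heat_semigroup_BLO_bound(1)[OF f t m])
    show "ereal (heat_semigroup t f x)
        \<le> ess_inf (ball x (sqrt t)) f + ereal (1 + ?S) * enn2ereal (blo_norm f)"
      unfolding m N using bound[OF t m] by simp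
  }
  assume L: "lebesgue_point f x"
  show "(SUP t\<in>{0<..}. ereal (heat_semigroup t f x - f x)) \<le> ereal (1 + ?S) * enn2ereal (blo_norm f)"
  proof (rule SUP_least)
    fix t :: real
    assume "t \<in> {0<..}"
    then have t: "t > 0" by simp
    then obtain m where m: "ess_inf (ball x (sqrt t)) f = ereal m" using finite by blast
    \<comment> \<open>At a Lebesgue point \<open>m\<close> can be replaced by \<open>f x\<close> in
      \<open>bound\<close>, for every \<open>t\<close> with the same constant.\<close>
    have "m \<le> f x"
      using ess_inf_le_lebesgue_point[OF _ L, of "sqrt t"] f t m by (simp add: BLO_def)
    then show "ereal (heat_semigroup t f x - f x) \<le> ereal (1 + ?S) * enn2ereal (blo_norm f)"
      unfolding N using bound[OF t m] by simp
  qed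
qed

end
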